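(* Let $X$ be an $n$-dimensional Banach space and let $\{x_1,\dots,x_n\}$ be a basis of $X$ such that $x_i\perp_B \mathrm{span}\{x_j: 1\le j\le n,\ j\neq i\}$ for all $1\le i\le n$. Let $Y$ be a normed linear space. If $T\in\mathcal{L}(X,Y)$ with $\|T\|=1$ is such that, for each $1\le i\le n$, $T$ is $BD^{\varepsilon_i}$-P at $x_i$ for some $\varepsilon_i\in[0,1)$ and $Tx_i\neq0$, then $T$ is $BD^{\eta}$-P for some $\eta\in[0,1)$.
   Context: All normed spaces are real; $\mathcal{L}(X,Y)$ is the space of bounded linear operators from $X$ to $Y$ with the operator norm. $x\perp_B y$ means $\|x+\lambda y\|\ge\|x\|$ for all $\lambda\in\mathbb{R}$; for a subspace $M$, $x\perp_B M$ means $x\perp_B y$ for all $y\in M$. For $\varepsilon\in[0,1)$, $x\perp_{D^\varepsilon}y$ means $\|x+\lambda y\|\ge\sqrt{1-\varepsilon^2}\,\|x\|$ for all $\lambda\in\mathbb{R}$. For $\eta\in[0,1)$, $T$ is $BD^\eta$-P at $x\in X$ if for all $y\in X$, $x\perp_B y$ implies $Tx\perp_{D^\eta}Ty$; $T$ is $BD^\eta$-P if this holds at every $x\in X$ (with the same $\eta$). *)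

theory Defs
  imports "HOL-Analysis.Analysis"
begin

definition birkhoff_orth :: "'a::real_normed_vector \<Rightarrow> 'a \<Rightarrow> bool"
  where "birkhoff_orth x y \<longleftrightarrow> (\<forall>t::real. norm (x + t *\<^sub>R y) \<ge> norm x)"

definition birkhoff_orth_set :: "'a::real_normed_vector \<Rightarrow> 'a set \<Rightarrow> bool"
  where "birkhoff_orth_set x M \<longleftrightarrow> (\<forall>y\<in>M. birkhoff_orth x y)"

(* Used only for e in [0,1); this range is imposed wherever the notion is applied. *)
definition approx_orth_D :: "real \<Rightarrow> 'a::real_normed_vector \<Rightarrow> 'a \<Rightarrow> bool"
  where "approx_orth_D e x y \<longleftrightarrow> (\<forall>t::real. norm (x + t *\<^sub>R y) \<ge> sqrt (1 - e\<^sup>2) * norm x)"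

definition BD_preserving_at ::
    "real \<Rightarrow> ('a::real_normed_vector \<Rightarrow>\<^sub>L 'b::real_normed_vector) \<Rightarrow> 'a \<Rightarrow> bool"
  where "BD_preserving_at e T x \<longleftrightarrow>
    (\<forall>y. birkhoff_orth x y \<longrightarrow> approx_orth_D e (blinfun_apply T x) (blinfun_apply T y))"

definition BD_preserving ::
    "real \<Rightarrow> ('a::real_normed_vector \<Rightarrow>\<^sub>L 'b::real_normed_vector) \<Rightarrow> bool"
  where "BD_preserving e T \<longleftrightarrow> (\<forall>x. BD_preserving_at e T x)"

end

theory Submission
  imports Defs
begin

text \<open>
  Write \<open>z = \<Sum>i. a i *\<^sub>R x i\<close>. If \<open>a i \<noteq> 0\<close>, then \<open>z\<close> is \<open>a i\<close> times \<open>x i + w\<close> with \<open>x i\<close>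
  orthogonal to \<open>w\<close>, so preservation at \<open>x i\<close> bounds \<open>\<bar>a i\<bar>\<close> by a multiple of \<open>norm (T z)\<close>.
  Summing over \<open>i\<close> shows that \<open>T\<close> is bounded below, and a contraction that is bounded below
  preserves orthogonality approximately, because \<open>norm x \<le> norm (x + t *\<^sub>R y)\<close> can be
  transported through \<open>T\<close>.
\<close>

lemma BD_preserving_if_bounded_below:
  fixes T :: "'a::real_normed_vector \<Rightarrow>\<^sub>L 'b::real_normed_vector"
  assumes "norm T \<le> 1" and K: "K \<ge> 1"
    and below: "\<And>z. norm z \<le> K * norm (blinfun_apply T z)"
  shows "\<exists>h\<in>{0..<1}. BD_preserving h T"
proof
  \<comment> \<open>The chain below loses exactly the factor \<open>K\<close>, so \<open>h\<close>
    is chosen to make \<open>sqrt (1 - h\<^sup>2)\<close> equal to \<open>1 / K\<close>. The bound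
    \<open>K \<ge> 1\<close> keeps the root real, and \<open>1 / K > 0\<close> gives
    \<open>h < 1\<close>.\<close>
  define h where "h = sqrt (1 - (1 / K)\<^sup>2)"
  have K': "0 < 1 / K" "1 / K \<le> 1"
    using K by auto
  then have "(1 / K)\<^sup>2 \<le> 1" "0 < (1 / K)\<^sup>2"
    by (simp_all only: power_le_one zero_less_power less_imp_le)
  then show "h \<in> {0..<1}"
    by (simp add: h_def)
  have "h\<^sup>2 = 1 - (1 / K)\<^sup>2"
    unfolding h_def using \<open>(1 / K)\<^sup>2 \<le> 1\<close> by (intro real_sqrt_pow2) linarith
  then have "1 - h\<^sup>2 = (1 / K)\<^sup>2"
    by linarith
  then have h: "sqrt (1 - h\<^sup>2) = 1 / K"
    using K'(1) by (metis less_imp_le real_sqrt_unique)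
  show "BD_preserving h T"
    unfolding BD_preserving_def BD_preserving_at_def approx_orth_D_def
  proof (intro allI impI)
    fix x y :: 'a and t :: real
    assume "birkhoff_orth x y"
    have "norm (blinfun_apply T x) \<le> norm T * norm x"
      by (rule norm_blinfun)
    also have "\<dots> \<le> norm x"
      using assms(1) by (simp add: mult_left_le_one_le)
    also have "norm x \<le> norm (x + t *\<^sub>R y)"
      using \<open>birkhoff_orth x y\<close> by (simp add: birkhoff_orth_def)
    also have "\<dots> \<le> K * norm (blinfun_apply T (x + t *\<^sub>R y))"
      by (rule below)
    finally show "sqrt (1 - h\<^sup>2) * norm (blinfun_apply T x)
        \<le> norm (blinfun_apply T x + t *\<^sub>R blinfun_apply T y)"
      using K by (simp add: h field_simps blinfun.add_right blinfun.scaleR_right)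
  qed
qed

text \<open>For nonzero \<open>a\<close>, factor it out: \<open>(1 / a) *\<^sub>R w\<close> stays in
  \<open>M\<close>, so preservation at \<open>x\<close> applies to it, and the instance with
  parameter \<open>1\<close> is scaled back by \<open>\<bar>a\<bar>\<close>. For
  \<open>a = 0\<close> the left side vanishes.\<close>

lemma BD_preserving_at_coordinate_bound:
  assumes "BD_preserving_at e T x" and "subspace M" and "birkhoff_orth_set x M" and "w \<in> M"
  shows "\<bar>a\<bar> * (sqrt (1 - e\<^sup>2) * norm (blinfun_apply T x)) \<le> norm (blinfun_apply T (a *\<^sub>R x + w))"
proof (cases "a = 0")
  case False
  have "(1 / a) *\<^sub>R w \<in> M"
    using assms(2,4) by (rule subspace_scale)
  then have "approx_orth_D e (blinfun_apply T x) (blinfun_apply T ((1 / a) *\<^sub>R w))"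
    using assms(1,3) by (simp add: birkhoff_orth_set_def BD_preserving_at_def)
  then have "sqrt (1 - e\<^sup>2) * norm (blinfun_apply T x)
      \<le> norm (blinfun_apply T x + 1 *\<^sub>R blinfun_apply T ((1 / a) *\<^sub>R w))"
    unfolding approx_orth_D_def by blast
  then have "\<bar>a\<bar> * (sqrt (1 - e\<^sup>2) * norm (blinfun_apply T x))
      \<le> \<bar>a\<bar> * norm (blinfun_apply T x + blinfun_apply T ((1 / a) *\<^sub>R w))"
    by (simp add: mult_left_mono)
  also have "\<dots> = norm (a *\<^sub>R (blinfun_apply T x + blinfun_apply T ((1 / a) *\<^sub>R w)))"
    by simp
  also have "\<dots> = norm (blinfun_apply T (a *\<^sub>R x + w))"
    using False by (simp add: blinfun.add_right blinfun.scaleR_right scaleR_add_right)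
  finally show ?thesis .
qed simp

theorem theorem3p2:
  fixes n :: nat
    and x :: "nat \<Rightarrow> 'a::banach"
    and T :: "'a \<Rightarrow>\<^sub>L 'b::real_normed_vector"
  assumes dim: "dim (UNIV :: 'a set) = n"
    and basis: "inj_on x {1..n}" "independent (x ` {1..n})" "span (x ` {1..n}) = UNIV"
    and orth: "\<forall>i\<in>{1..n}. birkhoff_orth_set (x i) (span {x j | j. j \<in> {1..n} \<and> j \<noteq> i})"
    and norm_T: "norm T = 1"
    and local: "\<forall>i\<in>{1..n}. (\<exists>e\<in>{0..<1}. BD_preserving_at e T (x i)) \<and> blinfun_apply T (x i) \<noteq> 0"
  shows "\<exists>h\<in>{0..<1}. BD_preserving h T"
proof -
  define M where "M i = span {x j | j. j \<in> {1..n} \<and> j \<noteq> i}" for i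
  obtain e where e: "\<And>i. i \<in> {1..n} \<Longrightarrow> e i \<in> {0..<1} \<and> BD_preserving_at (e i) T (x i)"
    using local by metis
  \<comment> \<open>The factor from the coordinate bound; it is positive because
    \<open>e i < 1\<close> and \<open>T\<close> does not vanish at \<open>x i\<close>, so it can be
    divided by.\<close>
  define c where "c i = sqrt (1 - (e i)\<^sup>2) * norm (blinfun_apply T (x i))" for i
  have c: "c i > 0" if "i \<in> {1..n}" for i
  proof -
    have "(e i)\<^sup>2 < 1"
      using e[OF that] by (simp add: power_less_one_iff abs_square_less_1)
    then show ?thesis
      using local that by (simp add: c_def)
  qed
  \<comment> \<open>Each coordinate of \<open>z\<close> is at most \<open>norm (T z) / c i\<close>
    in absolute value; weighting by \<open>norm (x i)\<close> and summing yields this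
    constant.\<close>
  define C where "C = (\<Sum>i\<in>{1..n}. norm (x i) / c i)"
  have "C \<ge> 0"
    unfolding C_def using c by (intro sum_nonneg divide_nonneg_nonneg) (auto intro: less_imp_le)
  have below: "norm z \<le> C * norm (blinfun_apply T z)" for z
  proof -
    have "z \<in> range (\<lambda>u. \<Sum>v\<in>x ` {1..n}. u v *\<^sub>R v)"
      using basis(3) span_finite[of "x ` {1..n}"] by auto
    then obtain u where "z = (\<Sum>v\<in>x ` {1..n}. u v *\<^sub>R v)"
      by blast
    \<comment> \<open>Injectivity of \<open>x\<close> turns the sum over basis vectors into one over
      indices.\<close>
    then have z: "z = (\<Sum>i\<in>{1..n}. u (x i) *\<^sub>R x i)"
      using basis(1) by (simp add: sum.reindex)
    have coord: "\<bar>u (x i)\<bar> * c i \<le> norm (blinfun_apply T z)" if i: "i \<in> {1..n}" for i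
    proof -
      have split: "z = u (x i) *\<^sub>R x i + (\<Sum>j\<in>{1..n} - {i}. u (x j) *\<^sub>R x j)"
        unfolding z using i by (intro sum.remove) auto
      have "(\<Sum>j\<in>{1..n} - {i}. u (x j) *\<^sub>R x j) \<in> M i"
        unfolding M_def by (intro span_sum span_scale span_base) auto
      then show ?thesis
        unfolding c_def split
        using e[OF i] orth i
        by (intro BD_preserving_at_coordinate_bound[where M = "M i"]) (auto simp: M_def)
    qed
    have "norm z \<le> (\<Sum>i\<in>{1..n}. \<bar>u (x i)\<bar> * norm (x i))"
      unfolding z by (rule sum_norm_le) simp
    also have "\<dots> \<le> (\<Sum>i\<in>{1..n}. (norm (blinfun_apply T z) / c i) * norm (x i))"
      using coord c by (intro sum_mono mult_right_mono) (auto simp: pos_le_divide_eq)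
    also have "\<dots> = C * norm (blinfun_apply T z)"
      unfolding C_def sum_distrib_right by (rule sum.cong) simp_all
    finally show ?thesis .
  qed
  show ?thesis
  proof (rule BD_preserving_if_bounded_below)
    \<comment> \<open>Adding 1 meets the requirement \<open>K \<ge> 1\<close> from
      \<open>C \<ge> 0\<close> alone.\<close>
    show "norm z \<le> (C + 1) * norm (blinfun_apply T z)" for z
      using below[of z] by (simp add: distrib_right add_increasing2)
  qed (use norm_T \<open>C \<ge> 0\<close> in auto)
qed

end
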